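(* Let $R \in [2\sqrt{2}, 4]$ and consider the set $D:=D(0,R)\setminus D(0,2)^o \subset \mathbb{R}^2$. Assume that $A$ is a measurable subset of $D$ such that $\operatorname{diam}(A)\leq 2$. Then \[ \lambda_2(A)\leq R^2\arcsin\left(\frac{a}{R}\right)-4\arcsin\left(\frac{a}{2}\right)+2\arccos(a) , \] where $a=\sqrt{\frac{-R^4+16R^2}{8(R^2+2)}}$.
   Context: $\lambda_2$ denotes $2$-dimensional Lebesgue measure. $D(p,r)$ is the closed Euclidean disk of center $p$ and radius $r$ in $\mathbb{R}^2$, and $D(p,r)^o$ is its interior. *)

theory Defs
  imports "HOL-Analysis.Analysis"
begin

end

theory Submission
  imports Defs
begin

text \<open>The extremal set is the intersection of the annulus with a unit disc, placed so that a diameter of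
the disc joins a point of the outer circle to a point of the inner one. Annuli are given by squared radii
in what follows: \<open>disc_area p q\<close> is the area of such an intersection for the annulus between the radii
\<open>sqrt p\<close> and \<open>sqrt q\<close>, and the right-hand side of the theorem is \<open>disc_area 4 (R\<^sup>2)\<close>
(\<open>disc_area_annulus\<close>).

The set \<open>A\<close> may be replaced by the part \<open>K\<close> in the annulus of the convex hull of its closure. This
still has diameter at most 2, and since the hull is connected, the radii of the points of \<open>K\<close> fill
an interval \<open>{sqrt p..sqrt q}\<close>. The map \<open>(u, t) \<mapsto> sqrt u (cos t, sin t)\<close> has Jacobian
determinant 1/2, so the area of \<open>K\<close> is half the integral over \<open>{p..q}\<close> of the length
\<open>g u\<close> of the set of angles of the points of \<open>K\<close> with squared radius \<open>u\<close>.

Two points of squared radii \<open>u\<close> and \<open>v\<close> at distance at most 2 differ in angle by at most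
the number \<open>\<phi>\<close> with \<open>cos \<phi> = (u + v - 4) / (2 sqrt u sqrt v)\<close>. As in the
one-dimensional Brunn-Minkowski inequality this gives \<open>g u + g v \<le> 2 \<phi>\<close>, provided both sets
are nonempty. For antipodal points of a unit disc with centre at distance \<open>c\<close> from the origin the
sum of squared radii is always \<open>2 (c\<^sup>2 + 1)\<close>; hence pairing \<open>u\<close> with
\<open>v = p + q - u\<close>, which preserves length on \<open>{p..q}\<close>, loses nothing for the extremal disc,
and the integral of \<open>\<phi>\<close> over \<open>{p..q}\<close> is \<open>2 disc_area p q\<close>
(\<open>has_integral_paired_angle\<close>). So \<open>K\<close> has area at most \<open>disc_area p q\<close>
(\<open>measure_le_disc_area_of_radii_interval\<close>).

Both the evaluation of this integral and the monotonicity of \<open>disc_area\<close> in the annulus, which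
gives \<open>disc_area p q \<le> disc_area 4 (R\<^sup>2)\<close>, follow from the formula for the derivative of
\<open>disc_area\<close> along a path of annuli (\<open>has_real_derivative_disc_area\<close>): since the position of the
disc is optimal, only the motion of the two circles contributes.\<close>


section \<open>The area of a unit disc in an annulus\<close>

text \<open>A unit disc whose boundary meets the circles of radii \<open>sqrt p\<close> and \<open>sqrt q\<close> about the
origin in the four points \<open>(c - s, \<plusminus>h)\<close> and \<open>(c + s, \<plusminus>h)\<close>, where \<open>(c, 0)\<close> is its
centre, has \<open>h\<close> equal to this number.\<close>

definition half_width :: "real \<Rightarrow> real \<Rightarrow> real" where
  "half_width p q = sqrt (1 - (q - p)\<^sup>2 / (8 * (p + q - 2)))"

text \<open>For \<open>p \<le> q\<close> between 4 and 16, the area of the part of that disc between the two circles. The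
last term is twice the angle \<open>arcsin s = arccos h\<close>; in this form the function is antisymmetric in \<open>p\<close> and \<open>q\<close>
(\<open>disc_area_swap\<close>) and has no singularity at \<open>p = q\<close>.\<close>

definition disc_area :: "real \<Rightarrow> real \<Rightarrow> real" where
  "disc_area p q = q * arcsin (half_width p q / sqrt q) - p * arcsin (half_width p q / sqrt p)
     + 2 * arcsin ((q - p) / sqrt (8 * (p + q - 2)))"

lemma half_width_commute: "half_width p q = half_width q p"
  unfolding half_width_def by (simp add: power2_commute add.commute)

text \<open>If \<open>X\<close> is the first coordinate of a moving point with second coordinate \<open>Y\<close> and squared norm
\<open>N\<close>, then \<open>N\<close> times the polar angle has derivative \<open>N'\<close> times the angle plus
\<open>X Y' - Y X'\<close>. Here \<open>X'\<close> is eliminated through \<open>N' = 2 (X X' + Y Y')\<close>.\<close>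

lemma has_real_derivative_sector:
  fixes N Y :: "real \<Rightarrow> real"
  assumes N: "(N has_real_derivative n') (at t)" and Y: "(Y has_real_derivative y') (at t)"
    and x: "x > 0" and Nt: "N t = x\<^sup>2 + (Y t)\<^sup>2"
  shows "((\<lambda>t. N t * arcsin (Y t / sqrt (N t))) has_real_derivative
    n' * arcsin (Y t / sqrt (N t)) + (N t * y' - Y t * n' / 2) / x) (at t)"
proof -
  have N0: "N t > 0" using x Nt by (simp add: add_pos_nonneg)
  define r where "r = sqrt (N t)"
  have r: "r > 0" "r\<^sup>2 = N t" "r\<^sup>2 = x\<^sup>2 + (Y t)\<^sup>2" using N0 Nt by (auto simp: r_def)
  have lt: "(Y t / r)\<^sup>2 < 1" unfolding power_divide r(3) using x by (simp add: add_pos_nonneg)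
  then have "\<bar>Y t / r\<bar> < 1" by (simp only: abs_square_less_1)
  then have ab: "-1 < Y t / r" "Y t / r < 1" by linarith+
  have sq: "sqrt (1 - (Y t / r)\<^sup>2) = x / r"
  proof (rule real_sqrt_unique)
    show "(x / r)\<^sup>2 = 1 - (Y t / r)\<^sup>2"
      using r N0 by (simp add: power_divide eq_diff_eq flip: add_divide_distrib)
  qed (use r x in auto)
  have "((\<lambda>t. sqrt (N t)) has_real_derivative inverse r / 2 * n') (at t)"
    unfolding r_def by (rule DERIV_chain2[OF DERIV_real_sqrt[OF N0] N])
  from DERIV_divide[OF Y this] r(1)
  have "((\<lambda>t. Y t / sqrt (N t)) has_real_derivative (y' * r - Y t * (inverse r / 2 * n')) / (r * r)) (at t)"
    by (simp add: r_def)
  from DERIV_chain2[OF DERIV_arcsin[OF ab[unfolded r_def]] this]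
  have "((\<lambda>t. arcsin (Y t / sqrt (N t))) has_real_derivative
      inverse (x / r) * ((y' * r - Y t * (inverse r / 2 * n')) / (r * r))) (at t)"
    unfolding sq[unfolded r_def] by (simp only: r_def)
  from DERIV_mult[OF N this]
  show ?thesis
  proof (rule DERIV_cong)
    have "inverse (x / r) * ((y' * r - Y t * (inverse r / 2 * n')) / (r * r)) * r\<^sup>2
        = (r\<^sup>2 * y' - Y t * n' / 2) / x"
      using r(1) x by (simp add: field_simps power2_eq_square)
    then show "n' * arcsin (Y t / sqrt (N t))
        + inverse (x / r) * ((y' * r - Y t * (inverse r / 2 * n')) / (r * r)) * N t
      = n' * arcsin (Y t / sqrt (N t)) + (N t * y' - Y t * n' / 2) / x"
      by (simp only: r(2))
  qed
qed

text \<open>The condition states that \<open>\<bar>sqrt q - sqrt p\<bar> \<le> 2\<close>, so that a unit disc can meet both circles.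
Equality holds only for \<open>{p, q} = {4, 16}\<close>.\<close>

lemma annulus_radii_gap:
  fixes p q :: real
  assumes "p \<in> {4..16}" "q \<in> {4..16}"
  shows "(q - p)\<^sup>2 \<le> 8 * (p + q - 2)" "\<bar>q - p\<bar> < 12 \<Longrightarrow> (q - p)\<^sup>2 < 8 * (p + q - 2)"
proof -
  \<comment> \<open>With \<open>m\<close> the smaller of the two numbers, the difference of the two sides is
    \<open>16 (m - 4) + (12 - d) (d + 4)\<close>.\<close>
  define d where "d = \<bar>q - p\<bar>"
  define m where "m = min p q"
  have d: "0 \<le> d" "d \<le> 12" "p + q = 2 * m + d" "4 \<le> m" "(q-p)\<^sup>2 = d\<^sup>2"
    using assms by (auto simp: d_def m_def min_def)
  have e: "8 * (p + q - 2) - (q - p)\<^sup>2 = 16 * (m - 4) + (12 - d) * (d + 4)"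
    unfolding d(3,5) by (simp add: algebra_simps power2_eq_square)
  have "(12 - d) * (d + 4) \<ge> 0" using d by auto
  then have "16 * (m - 4) + (12 - d) * (d + 4) \<ge> 0" using d(4) by (intro add_nonneg_nonneg) auto
  then show "(q - p)\<^sup>2 \<le> 8 * (p + q - 2)" unfolding e[symmetric] by (rule diff_ge_0_iff_ge[THEN iffD1])
  assume "\<bar>q - p\<bar> < 12"
  then have "(12 - d) * (d + 4) > 0" using d(1) by (auto simp: d_def)
  then have "16 * (m - 4) + (12 - d) * (d + 4) > 0" using d(4) by (intro add_nonneg_pos) auto
  then show "(q - p)\<^sup>2 < 8 * (p + q - 2)" unfolding e[symmetric] by (rule diff_gt_0_iff_gt[THEN iffD1])
qed

text \<open>The points \<open>(c - s, h)\<close> and \<open>(c + s, h)\<close>, where \<open>h\<close> is the half width, lie on the two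
circles, and on the unit circle about \<open>(c, 0)\<close>.\<close>

lemma disc_corner_points:
  fixes p q :: real
  assumes "p \<in> {4..16}" "q \<in> {4..16}"
  defines "c \<equiv> sqrt ((p + q - 2) / 2)"
  defines "s \<equiv> (q - p) / (4 * c)"
  shows "sqrt (8 * (p + q - 2)) = 4 * c" "c\<^sup>2 = (p + q - 2) / 2" "c > 1" "\<bar>s\<bar> \<le> 1"
    "(half_width p q)\<^sup>2 = 1 - s\<^sup>2" "half_width p q \<ge> 0"
    "p = (c - s)\<^sup>2 + (half_width p q)\<^sup>2" "q = (c + s)\<^sup>2 + (half_width p q)\<^sup>2"
proof -
  have ge: "4 \<le> p" "4 \<le> q" using assms(1,2) by auto
  have "8 * (p + q - 2) = 4\<^sup>2 * ((p + q - 2) / 2)" by simp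
  then show e: "sqrt (8 * (p + q - 2)) = 4 * c"
    unfolding c_def by (simp only: real_sqrt_mult real_sqrt_power[symmetric]) simp
  show c2: "c\<^sup>2 = (p + q - 2) / 2" unfolding c_def using ge by simp
  show c: "c > 1" unfolding c_def using ge by simp
  have s2: "s\<^sup>2 = (q - p)\<^sup>2 / (8 * (p + q - 2))"
    unfolding s_def power_divide power_mult_distrib c2 by (simp del: distrib_left_numeral right_diff_distrib_numeral)
  have s1: "s\<^sup>2 \<le> 1" unfolding s2 using annulus_radii_gap(1)[OF assms(1,2)] ge by simp
  then show "\<bar>s\<bar> \<le> 1" by (simp add: abs_square_le_1)
  show h: "(half_width p q)\<^sup>2 = 1 - s\<^sup>2"
    unfolding half_width_def s2[symmetric] using s1 by simp
  show "half_width p q \<ge> 0" unfolding half_width_def s2[symmetric] using s1 by simp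
  have "4 * (c * s) = q - p" unfolding s_def using c by simp
  then show "p = (c - s)\<^sup>2 + (half_width p q)\<^sup>2" "q = (c + s)\<^sup>2 + (half_width p q)\<^sup>2"
    unfolding h using c2 by (auto simp: power2_sum power2_diff)
qed

text \<open>With the corner points \<open>(c \<plusminus> s, h)\<close> moving, the two sector terms contribute
\<open>(c + s) h' - h (c' + s')\<close> and \<open>(c - s) h' - h (c' - s')\<close> besides the terms in the
conclusion. Their difference is \<open>2 (s h' - h s')\<close>, which cancels the derivative
\<open>2 s' / h\<close> of \<open>2 arcsin s\<close> because \<open>h\<^sup>2 + s\<^sup>2 = 1\<close>.\<close>

lemma has_real_derivative_disc_area:
  fixes P Q :: "real \<Rightarrow> real"
  assumes P: "(P has_real_derivative p') (at t)" and Q: "(Q has_real_derivative q') (at t)"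
    and mem: "P t \<in> {4..16}" "Q t \<in> {4..16}" and lt': "\<bar>Q t - P t\<bar> < 12"
  shows "((\<lambda>t. disc_area (P t) (Q t)) has_real_derivative
     q' * arcsin (half_width (P t) (Q t) / sqrt (Q t))
     - p' * arcsin (half_width (P t) (Q t) / sqrt (P t))) (at t)"
proof -
  define c where "c = sqrt ((P t + Q t - 2) / 2)"
  define s where "s = (Q t - P t) / (4 * c)"
  define y where "y = half_width (P t) (Q t)"
  have ge: "4 \<le> P t" "4 \<le> Q t" using mem by auto
  note lt = annulus_radii_gap(2)[OF mem lt']
  note d = disc_corner_points[OF mem, folded c_def, folded s_def, folded y_def]
  define c' where "c' = (p' + q') / (4 * c)"
  define s' where "s' = (q' - p') / (4 * c) - s * c' / c"
  define y' where "y' = - s * s' / y"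
  have sdef': "s = (Q t - P t) / sqrt (8 * (P t + Q t - 2))" unfolding d(1) s_def ..
  have s2: "s\<^sup>2 = (Q t - P t)\<^sup>2 / (8 * (P t + Q t - 2))"
    unfolding s_def power_divide power_mult_distrib d(2) by (simp del: distrib_left_numeral right_diff_distrib_numeral)
  have s1: "s\<^sup>2 < 1" unfolding s2 using lt ge by simp
  have y: "y > 0" using d(5,6) s1 by (metis diff_gt_0_iff_gt less_eq_real_def power_zero_numeral less_irrefl)
  have ab: "-1 < s" "s < 1" using s1 by (auto simp: abs_square_less_1)
  have yy: "y = sqrt (1 - s\<^sup>2)" unfolding y_def half_width_def s2 ..
  have dS: "((\<lambda>t. (Q t - P t) / sqrt (8 * (P t + Q t - 2))) has_real_derivative s') (at t)"
  proof -
    have e: "inverse (4*c) / 2 * (8 * (p' + q')) = 4 * c'"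
      unfolding c'_def using d(3) by (simp add: field_simps)
    have "((\<lambda>t. sqrt (8 * (P t + Q t - 2))) has_real_derivative 4 * c') (at t)"
      unfolding e[symmetric] d(1)[symmetric] using ge
      by (auto intro!: derivative_eq_intros P Q)
    from DERIV_divide[OF DERIV_diff[OF Q P] this]
    show ?thesis
      unfolding d(1)
      by (rule DERIV_cong) (use d(3) ge in \<open>auto simp: s'_def s_def field_simps power2_eq_square d(1)\<close>)
  qed
  have dY: "((\<lambda>t. half_width (P t) (Q t)) has_real_derivative y') (at t)"
  proof -
    have deriv: "((\<lambda>t. sqrt (1 - ((Q t - P t) / sqrt (8 * (P t + Q t - 2)))\<^sup>2)) has_real_derivative y') (at t)"
    proof -
      have "((\<lambda>t. sqrt (1 - (g t)\<^sup>2)) has_real_derivative y') (at t)"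
        if g: "(g has_real_derivative s') (at t)" "g t = s" for g
      proof -
        have "((\<lambda>t. 1 - (g t)\<^sup>2) has_real_derivative - (2 * s * s')) (at t)"
          using g by (auto intro!: derivative_eq_intros)
        moreover have "0 < 1 - (g t)\<^sup>2" using s1 g(2) by simp
        ultimately have "((\<lambda>t. sqrt (1 - (g t)\<^sup>2)) has_real_derivative
            inverse (sqrt (1 - (g t)\<^sup>2)) / 2 * - (2 * s * s')) (at t)"
          by (intro DERIV_chain2[OF DERIV_real_sqrt])
        moreover have "inverse (sqrt (1 - (g t)\<^sup>2)) / 2 * - (2 * s * s') = y'"
          unfolding g(2) yy[symmetric] y'_def using y by (simp add: field_simps)
        ultimately show ?thesis by (rule DERIV_cong)
      qed
      from this[OF dS, OF sdef'[symmetric]] show ?thesis .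
    qed
    have "\<forall>\<^sub>F t in nhds t. P t + Q t > 2"
    proof -
      have "isCont (\<lambda>t. P t + Q t) t" by (intro continuous_add DERIV_isCont[OF P] DERIV_isCont[OF Q])
      then have "\<forall>\<^sub>F t in at t. P t + Q t > 2" unfolding isCont_def
        by (rule order_tendstoD) (use ge in auto)
      then show ?thesis using ge unfolding eventually_nhds_conv_at by linarith
    qed
    then have "\<forall>\<^sub>F t in nhds t. sqrt (1 - ((Q t - P t) / sqrt (8 * (P t + Q t - 2)))\<^sup>2) = half_width (P t) (Q t)"
      by eventually_elim (simp add: half_width_def power_divide)
    from DERIV_cong_ev[OF refl this refl] deriv show ?thesis by (rule iffD1)
  qed
  have pos: "c - s > 0" "c + s > 0" using d(3,4) by auto
  have dA: "((\<lambda>t. 2 * arcsin ((Q t - P t) / sqrt (8 * (P t + Q t - 2)))) has_real_derivative 2 * s' / y) (at t)"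
  proof -
    have "((\<lambda>t. 2 * arcsin (g t)) has_real_derivative 2 * s' / y) (at t)"
      if g: "(g has_real_derivative s') (at t)" "g t = s" for g
    proof -
      have "((\<lambda>t. arcsin (g t)) has_real_derivative inverse (sqrt (1 - (g t)\<^sup>2)) * s') (at t)"
        using ab g(2) by (intro DERIV_chain2[OF DERIV_arcsin g(1)]) simp_all
      from DERIV_cmult[OF this, of 2] show ?thesis
        unfolding g(2) yy[symmetric] by (rule DERIV_cong) (use y in \<open>simp add: field_simps\<close>)
    qed
    from this[OF dS, OF sdef'[symmetric]] show ?thesis .
  qed
  have main: "((\<lambda>t. disc_area (P t) (Q t)) has_real_derivative
      (q' * arcsin (y / sqrt (Q t)) + (Q t * y' - y * q' / 2) / (c + s))
    - (p' * arcsin (y / sqrt (P t)) + (P t * y' - y * p' / 2) / (c - s)) + 2 * s' / y) (at t)"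
    unfolding disc_area_def y_def
    by (intro DERIV_add DERIV_diff has_real_derivative_sector P Q dY dA[unfolded y_def] pos d(7,8)[unfolded y_def])
  have cc: "4 * c * c' = p' + q'" unfolding c'_def using d(3) by simp
  have ss: "4 * c * s' + 4 * s * c' = q' - p'" unfolding s'_def using d(3) by (simp add: field_simps)
  \<comment> \<open>The derivatives of \<open>(c + s)\<^sup>2 + h\<^sup>2 = c\<^sup>2 + 2 c s + 1\<close> and of its counterpart for \<open>p\<close>.\<close>
  have q': "q' = 2 * (c + s) * (c' + s') - 2 * s * s'"
    and p': "p' = 2 * (c - s) * (c' - s') - 2 * s * s'"
    using cc ss by (auto simp: algebra_simps)
  have yy': "y * y' = - s * s'" unfolding y'_def using y by simp
  have 1: "(Q t * y' - y * q' / 2) / (c + s) = (c + s) * y' - y * (c' + s')"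
  proof -
    have "Q t * y' - y * q' / 2 = ((c + s) * y' - y * (c' + s')) * (c + s)"
      using yy' unfolding d(8) q' by algebra
    then show ?thesis using pos by simp
  qed
  have 2: "(P t * y' - y * p' / 2) / (c - s) = (c - s) * y' - y * (c' - s')"
  proof -
    have "P t * y' - y * p' / 2 = ((c - s) * y' - y * (c' - s')) * (c - s)"
      using yy' unfolding d(7) p' by algebra
    then show ?thesis using pos by simp
  qed
  have "s * y' - y * s' + s' / y = 0"
  proof -
    have "y * (s * y' - y * s' + s' / y) = s * (y * y') - y\<^sup>2 * s' + s'"
      using y by (simp add: algebra_simps power2_eq_square)
    also have "\<dots> = 0" unfolding yy' d(5) by (simp add: algebra_simps power2_eq_square)
    finally show ?thesis using y by simp
  qed
  moreover have "((c + s) * y' - y * (c' + s')) - ((c - s) * y' - y * (c' - s')) + 2 * s' / y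
      = 2 * (s * y' - y * s' + s' / y)"
    by (simp add: algebra_simps)
  ultimately have 3: "((c + s) * y' - y * (c' + s')) - ((c - s) * y' - y * (c' - s')) + 2 * s' / y = 0"
    by simp
  show ?thesis
    by (rule DERIV_cong[OF main]) (use 3 in \<open>simp add: 1 2 y_def[symmetric]\<close>)
qed

lemma half_width_ratio_le_1:
  assumes "p \<in> {4..16}" "q \<in> {4..16}"
  shows "half_width p q / sqrt q \<in> {0..1}" "half_width p q / sqrt p \<in> {0..1}"
    "(q - p) / sqrt (8 * (p + q - 2)) \<in> {-1..1}"
proof -
  note d = disc_corner_points[OF assms]
  have "half_width p q \<le> sqrt q" "half_width p q \<le> sqrt p"
    by (rule real_le_rsqrt, subst d(8), simp) (rule real_le_rsqrt, subst d(7), simp)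
  then show "half_width p q / sqrt q \<in> {0..1}" "half_width p q / sqrt p \<in> {0..1}"
    using assms(1,2) d(6) by auto
  show "(q - p) / sqrt (8 * (p + q - 2)) \<in> {-1..1}"
    using d(4) unfolding d(1) abs_le_iff atLeastAtMost_iff by linarith
qed

lemma disc_area_swap:
  assumes "p \<in> {4..16}" "q \<in> {4..16}"
  shows "disc_area q p = - disc_area p q"
proof -
  have "(p - q) / sqrt (8 * (q + p - 2)) = - ((q - p) / sqrt (8 * (p + q - 2)))"
    unfolding add.commute[of q p] minus_divide_left minus_diff_eq ..
  moreover have "arcsin (- ((q - p) / sqrt (8 * (p + q - 2)))) = - arcsin ((q - p) / sqrt (8 * (p + q - 2)))"
    using half_width_ratio_le_1(3)[OF assms] by (intro arcsin_minus) auto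
  ultimately show ?thesis
    unfolding disc_area_def half_width_commute[of q p] by (simp only:)
qed

lemma continuous_on_disc_area:
  assumes "continuous_on S P" "continuous_on S Q"
    and ge: "\<And>t. t \<in> S \<Longrightarrow> P t \<in> {4..16} \<and> Q t \<in> {4..16}"
  shows "continuous_on S (\<lambda>t. disc_area (P t) (Q t))"
proof -
  have h: "continuous_on S (\<lambda>t. half_width (P t) (Q t))"
    unfolding half_width_def
    by (intro continuous_intros assms) (use ge in force)
  have r: "half_width (P t) (Q t) / sqrt (Q t) \<in> {0..1}" "half_width (P t) (Q t) / sqrt (P t) \<in> {0..1}"
    "(Q t - P t) / sqrt (8 * (P t + Q t - 2)) \<in> {-1..1}" if "t \<in> S" for t
    using half_width_ratio_le_1 ge[OF that] by blast+
  have b: "-1 \<le> half_width (P t) (Q t) / sqrt (Q t) \<and> half_width (P t) (Q t) / sqrt (Q t) \<le> 1"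
    "-1 \<le> half_width (P t) (Q t) / sqrt (P t) \<and> half_width (P t) (Q t) / sqrt (P t) \<le> 1"
    "-1 \<le> (Q t - P t) / sqrt (8 * (P t + Q t - 2)) \<and> (Q t - P t) / sqrt (8 * (P t + Q t - 2)) \<le> 1"
    if "t \<in> S" for t
    using r[OF that] by (auto intro: order_trans[of "-1" 0])
  show ?thesis unfolding disc_area_def
    by (intro continuous_intros assms h ballI b) (use ge in force)+
qed

lemma arcsin_half_width_nonneg:
  assumes "p \<in> {4..16}" "q \<in> {4..16}"
  shows "arcsin (half_width p q / sqrt q) \<in> {0..pi/2}" "arcsin (half_width p q / sqrt p) \<in> {0..pi/2}"
  using half_width_ratio_le_1[OF assms]
  unfolding atLeastAtMost_iff by (intro conjI arcsin_nonneg arcsin_ubound; simp)+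

text \<open>The derivative in \<open>q\<close> and the negative of the one in \<open>p\<close> are angles in \<open>{0..pi/2}\<close>. The
derivatives may fail to exist at the end of the path when \<open>p' = 4\<close> and \<open>q' = 16\<close>, where the
half width vanishes.\<close>

lemma disc_area_mono:
  assumes "4 \<le> p'" "p' \<le> p" "p \<le> q" "q \<le> q'" "q' \<le> 16"
  shows "disc_area p q \<le> disc_area p' q'"
proof -
  have "disc_area p q \<le> disc_area p q'"
  proof (rule DERIV_nonneg_imp_increasing_open[OF \<open>q \<le> q'\<close>])
    fix t assume t: "q < t" "t < q'"
    have "(disc_area p has_real_derivative
       1 * arcsin (half_width p t / sqrt t) - 0 * arcsin (half_width p t / sqrt p)) (at t)"
      using assms t by (intro has_real_derivative_disc_area[where P = "\<lambda>_. p"]) auto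
    moreover have "arcsin (half_width p t / sqrt t) \<ge> 0"
      using arcsin_half_width_nonneg(1)[of p t] assms t by auto
    ultimately show "\<exists>y. (disc_area p has_real_derivative y) (at t) \<and> 0 \<le> y"
      by auto
  next
    show "continuous_on {q..q'} (disc_area p)"
      using assms by (intro continuous_on_disc_area) (auto intro!: continuous_intros)
  qed
  also have "disc_area p q' \<le> disc_area p' q'"
  proof -
    have "- disc_area p' q' \<le> - disc_area p q'"
    proof (rule DERIV_nonneg_imp_increasing_open[OF \<open>p' \<le> p\<close>])
      fix t assume t: "p' < t" "t < p"
      have "((\<lambda>p. disc_area p q') has_real_derivative
         0 * arcsin (half_width t q' / sqrt q') - 1 * arcsin (half_width t q' / sqrt t)) (at t)"
        using assms t by (intro has_real_derivative_disc_area[where P = "\<lambda>t. t"]) auto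
      from DERIV_minus[OF this]
      have "((\<lambda>p. - disc_area p q') has_real_derivative arcsin (half_width t q' / sqrt t)) (at t)"
        by simp
      moreover have "arcsin (half_width t q' / sqrt t) \<ge> 0"
        using arcsin_half_width_nonneg(2)[of t q'] assms t by auto
      ultimately show "\<exists>y. ((\<lambda>p. - disc_area p q') has_real_derivative y) (at t) \<and> 0 \<le> y"
        by auto
    next
      show "continuous_on {p'..p} (\<lambda>p. - disc_area p q')"
        using assms by (intro continuous_on_minus continuous_on_disc_area)
          (auto intro!: continuous_intros)
    qed
    then show ?thesis by simp
  qed
  finally show ?thesis .
qed

text \<open>The largest angle between two points of squared radii \<open>u\<close> and \<open>v\<close> at distance at most 2
(compare \<open>cos_paired_angle\<close>): the angle between the corner points \<open>(c - s, h)\<close> and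
\<open>(c + s, -h)\<close>, which are antipodal on the unit disc.\<close>

definition paired_angle :: "real \<Rightarrow> real \<Rightarrow> real" where
  "paired_angle u v = arcsin (half_width u v / sqrt u) + arcsin (half_width u v / sqrt v)"

text \<open>Along the path \<open>u \<mapsto> (p + q - u, u)\<close> the derivative of \<open>disc_area\<close> is the integrand; the path
ends at \<open>(p, q)\<close> and starts at \<open>(q, p)\<close>, where \<open>disc_area\<close> has the opposite value.\<close>

lemma has_integral_paired_angle:
  assumes "4 \<le> p" "p \<le> q" "q \<le> 16"
  shows "((\<lambda>u. paired_angle u (p + q - u)) has_integral 2 * disc_area p q) {p..q}"
proof -
  have "((\<lambda>u. paired_angle u (p + q - u)) has_integral
      disc_area (p + q - q) q - disc_area (p + q - p) p) {p..q}"
  proof (rule fundamental_theorem_of_calculus_interior[OF \<open>p \<le> q\<close>])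
    show "continuous_on {p..q} (\<lambda>u. disc_area (p + q - u) u)"
      using assms by (intro continuous_on_disc_area) (auto intro!: continuous_intros)
    fix u assume u: "u \<in> {p<..<q}"
    have "((\<lambda>u. disc_area (p + q - u) u) has_real_derivative
       1 * arcsin (half_width (p + q - u) u / sqrt u)
       - (-1) * arcsin (half_width (p + q - u) u / sqrt (p + q - u))) (at u)"
      using assms u
      by (intro has_real_derivative_disc_area)
        (auto intro!: derivative_eq_intros)
    then show "((\<lambda>u. disc_area (p + q - u) u) has_vector_derivative paired_angle u (p + q - u)) (at u)"
      by (simp add: has_real_derivative_iff_has_vector_derivative paired_angle_def
          half_width_commute[of u])
  qed
  then show ?thesis using disc_area_swap[of p q] assms by simp
qed

lemma cos_paired_angle:
  assumes "u \<in> {4..16}" "v \<in> {4..16}"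
  shows "cos (paired_angle u v) = (u + v - 4) / (2 * sqrt u * sqrt v)"
    "paired_angle u v \<in> {0..pi}"
proof -
  define c where "c = sqrt ((u + v - 2) / 2)"
  define s where "s = (v - u) / (4 * c)"
  define y where "y = half_width u v"
  note d = disc_corner_points[OF assms, folded c_def, folded s_def, folded y_def]
  note r = half_width_ratio_le_1[OF assms, folded y_def]
  have pos: "c - s \<ge> 0" "c + s \<ge> 0" using d(3,4) by auto
  have cu: "cos (arcsin (y / sqrt u)) = (c - s) / sqrt u"
  proof -
    have "1 - (y / sqrt u)\<^sup>2 = ((c - s) / sqrt u)\<^sup>2"
      unfolding power_divide eq_diff_eq[THEN iffD2, OF d(7)[symmetric]]
      using assms(1) by (simp add: diff_divide_distrib)
    then show ?thesis using r pos assms(1) by (subst cos_arcsin) (auto intro: order_trans[of "-1" 0])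
  qed
  have cv: "cos (arcsin (y / sqrt v)) = (c + s) / sqrt v"
  proof -
    have "1 - (y / sqrt v)\<^sup>2 = ((c + s) / sqrt v)\<^sup>2"
      unfolding power_divide eq_diff_eq[THEN iffD2, OF d(8)[symmetric]]
      using assms(2) by (simp add: diff_divide_distrib)
    then show ?thesis using r pos assms(2) by (subst cos_arcsin) (auto intro: order_trans[of "-1" 0])
  qed
  have su: "sin (arcsin (y / sqrt u)) = y / sqrt u" "sin (arcsin (y / sqrt v)) = y / sqrt v"
    using r by (auto intro!: sin_arcsin intro: order_trans[of "-1" 0])
  have "cos (paired_angle u v) = ((c - s) * (c + s) - y\<^sup>2) / (sqrt u * sqrt v)"
    unfolding paired_angle_def cos_add y_def[symmetric] cu cv su
      times_divide_times_eq diff_divide_distrib[symmetric] power2_eq_square ..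
  also have "(c - s) * (c + s) - y\<^sup>2 = (u + v - 4) / 2"
    unfolding d(5) using d(2) by (simp add: algebra_simps power2_eq_square)
  finally show "cos (paired_angle u v) = (u + v - 4) / (2 * sqrt u * sqrt v)" by simp
  show "paired_angle u v \<in> {0..pi}"
    unfolding paired_angle_def using arcsin_half_width_nonneg[OF assms] by auto
qed

text \<open>In terms of the number \<open>s\<close> with \<open>a = sqrt (1 - s\<^sup>2)\<close>, the term \<open>arccos a\<close> is
\<open>arcsin s\<close>.\<close>

lemma disc_area_annulus:
  assumes "2 \<le> R" "R \<le> 4" and a: "a = sqrt ((- (R ^ 4) + 16 * R\<^sup>2) / (8 * (R\<^sup>2 + 2)))"
  shows "disc_area 4 (R\<^sup>2) = R\<^sup>2 * arcsin (a / R) - 4 * arcsin (a / 2) + 2 * arccos a"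
proof -
  have R: "4 \<le> R\<^sup>2" "R\<^sup>2 \<le> 16"
    using power_mono[OF assms(1), of 2] power_mono[OF assms(2), of 2] assms(1) by auto
  have h: "half_width 4 (R\<^sup>2) = a"
  proof -
    have "R\<^sup>2 + 2 \<noteq> 0" using R by auto
    then have "1 - (R\<^sup>2 - 4)\<^sup>2 / (8 * (4 + R\<^sup>2 - 2)) = (- (R ^ 4) + 16 * R\<^sup>2) / (8 * (R\<^sup>2 + 2))"
      by (simp add: field_simps power2_eq_square power4_eq_xxxx)
    then show ?thesis unfolding half_width_def a by simp
  qed
  define s where "s = (R\<^sup>2 - 4) / sqrt (8 * (4 + R\<^sup>2 - 2))"
  have s: "0 \<le> s" "s \<le> 1"
    using half_width_ratio_le_1(3)[of 4 "R\<^sup>2"] R by (auto simp: s_def)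
  have as: "a = sqrt (1 - s\<^sup>2)"
    unfolding h[symmetric] half_width_def s_def power_divide using R by simp
  have "cos (arcsin s) = a" unfolding as using s by (intro cos_arcsin) auto
  moreover have "arcsin s \<in> {0..pi}"
    using s arcsin_bounded[of s] arcsin_nonneg[of s] pi_gt_zero by auto
  ultimately have "arccos a = arcsin s" by (metis arccos_cos atLeastAtMost_iff)
  then show ?thesis unfolding disc_area_def h s_def[symmetric] using assms(1) by (simp add: real_sqrt_unique[of 2])
qed

section \<open>Plane measure by slices\<close>

text \<open>The identification of \<open>real \<times> real\<close> with \<open>real ^ 2\<close>. It carries Fubini's theorem for
product measures over to \<open>real ^ 2\<close>, where the change of variables takes place.\<close>

definition vec2 :: "real \<times> real \<Rightarrow> real ^ 2" where
  "vec2 z = vector [fst z, snd z]"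

lemma vec2_nth [simp]: "vec2 z $ 1 = fst z" "vec2 z $ 2 = snd z"
  by (simp_all add: vec2_def)

lemma continuous_on_vec2: "continuous_on S vec2"
proof -
  have eq: "vec2 = (\<lambda>z. \<chi> i. if i = 1 then fst z else snd z)"
    by (auto simp: fun_eq_iff vec_eq_iff forall_2)
  have "continuous_on S (\<lambda>z. if i = 1 then fst z else snd z :: real)" for i :: 2
    by (cases "i = 1") (auto intro: continuous_intros)
  then show ?thesis unfolding eq by (rule continuous_on_vec_lambda)
qed

lemma lborel_vec2: "lborel = distr lborel borel vec2"
proof (rule lborel_eqI)
  have m [measurable]: "vec2 \<in> borel_measurable borel"
    by (intro borel_measurable_continuous_onI continuous_on_vec2)
  have B: "Basis = {axis 1 1, axis 2 1 :: real ^ 2}"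
    by (auto simp: Basis_vec_def UNIV_2)
  have ne: "axis 1 1 \<noteq> (axis 2 1 :: real ^ 2)" by (simp add: axis_eq_axis)
  fix l u :: "real ^ 2" assume "\<And>b. b \<in> Basis \<Longrightarrow> l \<bullet> b \<le> u \<bullet> b"
  from this[of "axis 1 1"] this[of "axis 2 1"]
  have le: "l $ 1 \<le> u $ 1" "l $ 2 \<le> u $ 2" by (simp_all add: B inner_axis)
  have "vec2 -` box l u = {l $ 1<..<u $ 1} \<times> {l $ 2<..<u $ 2}"
    by (auto simp: mem_box_cart forall_2)
  then have "emeasure (distr lborel borel vec2) (box l u)
      = emeasure (lborel \<Otimes>\<^sub>M lborel) ({l $ 1<..<u $ 1} \<times> {l $ 2<..<u $ 2})"
    by (simp add: emeasure_distr lborel_prod)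
  also have "\<dots> = ennreal (u $ 1 - l $ 1) * ennreal (u $ 2 - l $ 2)"
    using le by (simp add: lborel.emeasure_pair_measure_Times)
  also have "\<dots> = ennreal (\<Prod>b\<in>Basis. (u - l) \<bullet> b)"
    using le ne by (simp add: B inner_axis ennreal_mult)
  finally show "emeasure (distr lborel borel vec2) (box l u) = ennreal (\<Prod>b\<in>Basis. (u - l) \<bullet> b)" .
qed simp

lemma emeasure_lborel_slices:
  fixes S :: "(real ^ 2) set"
  assumes S: "S \<in> sets borel"
  shows "emeasure lborel S = (\<integral>\<^sup>+u. emeasure lborel {t. vec2 (u, t) \<in> S} \<partial>lborel)"
    and "(\<lambda>u. emeasure lborel {t. vec2 (u, t) \<in> S}) \<in> borel_measurable borel"
    and "{t. vec2 (u, t) \<in> S} \<in> sets borel"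
proof -
  have m: "vec2 \<in> borel_measurable borel"
    by (intro borel_measurable_continuous_onI continuous_on_vec2)
  have X: "vec2 -` S \<in> sets (lborel \<Otimes>\<^sub>M lborel)"
    using measurable_sets[OF m S] unfolding lborel_prod by simp
  have eq: "Pair u -` (vec2 -` S) = {t. vec2 (u, t) \<in> S}" for u by auto
  have "emeasure lborel S = emeasure (lborel \<Otimes>\<^sub>M lborel) (vec2 -` S)"
    using m S by (subst lborel_vec2) (simp add: emeasure_distr lborel_prod)
  also have "\<dots> = (\<integral>\<^sup>+u. emeasure lborel (Pair u -` (vec2 -` S)) \<partial>lborel)"
    by (rule lborel.emeasure_pair_measure_alt[OF X])
  finally show "emeasure lborel S = (\<integral>\<^sup>+u. emeasure lborel {t. vec2 (u, t) \<in> S} \<partial>lborel)"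
    by (simp only: eq)
  show "(\<lambda>u. emeasure lborel {t. vec2 (u, t) \<in> S}) \<in> borel_measurable borel"
    using lborel.measurable_emeasure_Pair[OF X] by (simp add: eq)
  show "{t. vec2 (u, t) \<in> S} \<in> sets borel"
    using sets_Pair1[OF X, of u] by (simp add: eq)
qed

text \<open>Both \<open>Sup X - Inf Y\<close> and \<open>Sup Y - Inf X\<close> are at most \<open>d\<close>, and their sum bounds the sum of the
two lengths. Nonemptiness matters: the lemma fails for \<open>Y = {}\<close>.\<close>

lemma emeasure_add_le_of_cross_dist_le:
  fixes X Y :: "real set"
  assumes ne: "X \<noteq> {}" "Y \<noteq> {}" and d: "\<And>x y. x \<in> X \<Longrightarrow> y \<in> Y \<Longrightarrow> \<bar>x - y\<bar> \<le> d"
  shows "emeasure lborel X + emeasure lborel Y \<le> ennreal (2 * d)"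
proof -
  obtain x y where xy: "x \<in> X" "y \<in> Y" using ne by auto
  have bX: "bdd_above X" "bdd_below X"
    using d[OF _ xy(2)] by (auto intro!: bdd_aboveI[of _ "y + d"] bdd_belowI[of _ "y - d"] simp: abs_le_iff) (smt (verit))+
  have bY: "bdd_above Y" "bdd_below Y"
    using d[OF xy(1)] by (auto intro!: bdd_aboveI[of _ "x + d"] bdd_belowI[of _ "x - d"] simp: abs_le_iff) (smt (verit))+
  have s1: "Sup X \<le> Inf Y + d"
  proof (rule cSup_least[OF ne(1)])
    fix z assume z: "z \<in> X"
    have "z - d \<le> Inf Y" by (rule cInf_greatest[OF ne(2)]) (use d[OF z] in \<open>auto simp: abs_le_iff algebra_simps\<close>)
    then show "z \<le> Inf Y + d" by simp
  qed
  have s2: "Sup Y \<le> Inf X + d"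
  proof (rule cSup_least[OF ne(2)])
    fix z assume z: "z \<in> Y"
    have "z - d \<le> Inf X" by (rule cInf_greatest[OF ne(1)]) (use d[OF _ z] in \<open>auto simp: abs_le_iff algebra_simps\<close>)
    then show "z \<le> Inf X + d" by simp
  qed
  have "emeasure lborel X \<le> emeasure lborel {Inf X..Sup X}"
    by (rule emeasure_mono) (simp_all add: subset_eq cInf_lower cSup_upper bX)
  moreover have "emeasure lborel Y \<le> emeasure lborel {Inf Y..Sup Y}"
    by (rule emeasure_mono) (simp_all add: subset_eq cInf_lower cSup_upper bY)
  moreover have "Inf X \<le> Sup X" "Inf Y \<le> Sup Y"
    by (rule cInf_le_cSup[OF ne(1) bX], rule cInf_le_cSup[OF ne(2) bY])
  ultimately have "emeasure lborel X + emeasure lborel Y \<le> ennreal (Sup X - Inf X) + ennreal (Sup Y - Inf Y)"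
    by (intro add_mono) simp_all
  also have "\<dots> = ennreal ((Sup X - Inf X) + (Sup Y - Inf Y))"
    using \<open>Inf X \<le> Sup X\<close> \<open>Inf Y \<le> Sup Y\<close> by simp
  also have "\<dots> \<le> ennreal (2 * d)" using s1 s2 by (intro ennreal_leI) simp
  finally show ?thesis .
qed

text \<open>Polar coordinates in which the first coordinate is the squared radius and the second is the angle
relative to the direction \<open>\<theta>\<close>. With the squared radius the Jacobian determinant is constant.\<close>

definition polar :: "real \<Rightarrow> real ^ 2 \<Rightarrow> real ^ 2" where
  "polar \<theta> x = vec2 (sqrt (x $ 1) * cos (\<theta> + x $ 2), sqrt (x $ 1) * sin (\<theta> + x $ 2))"

text \<open>The Jacobian matrix of \<open>polar \<theta>\<close> at \<open>x\<close>.\<close>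

definition polar_jac :: "real \<Rightarrow> real ^ 2 \<Rightarrow> real ^ 2 ^ 2" where
  "polar_jac \<theta> x = vector
     [vector [cos (\<theta> + x $ 2) / (2 * sqrt (x $ 1)), - sqrt (x $ 1) * sin (\<theta> + x $ 2)],
      vector [sin (\<theta> + x $ 2) / (2 * sqrt (x $ 1)), sqrt (x $ 1) * cos (\<theta> + x $ 2)]]"

lemma det_polar_jac: "x $ 1 > 0 \<Longrightarrow> det (polar_jac \<theta> x) = 1 / 2"
proof -
  assume x: "x $ 1 > 0"
  have "det (polar_jac \<theta> x) = ((sin (\<theta> + x $ 2))\<^sup>2 + (cos (\<theta> + x $ 2))\<^sup>2) / 2"
    using x unfolding det_2 polar_jac_def by (simp add: field_simps power2_eq_square)
  then show ?thesis by simp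
qed

lemma has_derivative_polar:
  assumes x: "x $ 1 > 0"
  shows "(polar \<theta> has_derivative (\<lambda>h. polar_jac \<theta> x *v h)) (at x within S)"
proof -
  have nth: "((\<lambda>x. x $ i) has_derivative (\<lambda>h. h $ i)) (at x within S)" for i :: 2
    by (rule bounded_linear.has_derivative[OF bounded_linear_vec_nth]) (rule has_derivative_ident)
  have "((\<lambda>x. polar \<theta> x \<bullet> b) has_derivative (\<lambda>h. (polar_jac \<theta> x *v h) \<bullet> b)) (at x within S)"
    if "b \<in> Basis" for b
  proof -
    have "((\<lambda>x. polar \<theta> x $ i) has_derivative (\<lambda>h. (polar_jac \<theta> x *v h) $ i)) (at x within S)" for i
    proof (cases "i = 1")
      case True
      then show ?thesis unfolding polar_def polar_jac_def using x
        by (auto intro!: derivative_eq_intros nth simp: matrix_vector_mult_def sum_2 fun_eq_iff field_simps)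
    next
      case False
      then have "i = 2" using exhaust_2[of i] by simp
      then show ?thesis unfolding polar_def polar_jac_def using x
        by (auto intro!: derivative_eq_intros nth simp: matrix_vector_mult_def sum_2 fun_eq_iff field_simps)
    qed
    then show ?thesis using that by (auto simp: Basis_vec_def inner_axis)
  qed
  then show ?thesis by (subst has_derivative_componentwise_within) blast
qed

lemma measure_polar_image:
  assumes U: "compact U" "\<And>x. x \<in> U \<Longrightarrow> x $ 1 > 0" and inj: "inj_on (polar \<theta>) U"
  shows "measure lebesgue (polar \<theta> ` U) = measure lebesgue U / 2"
proof -
  have meas: "U \<in> lmeasurable" using U(1) by (rule lmeasurable_compact)
  have det: "\<bar>det (matrix (\<lambda>h. polar_jac \<theta> x *v h))\<bar> = 1 / 2" if "x \<in> U" for x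
    unfolding matrix_of_matrix_vector_mul det_polar_jac[OF U(2)[OF that]] by (rule abs_of_pos) simp
  have half: "((\<lambda>x. 1 / 2 :: real) has_integral (1 / 2) * measure lebesgue U) U"
  proof -
    have "((\<lambda>x. 1 :: real) has_integral measure lebesgue U) U"
      using integrable_integral[OF meas[unfolded lmeasurable_iff_integrable_on]]
      unfolding lmeasure_integral[OF meas] .
    from has_integral_mult_right[OF this, of "1/2"] show ?thesis by simp
  qed
  then have "((\<lambda>x. \<bar>det (matrix (\<lambda>h. polar_jac \<theta> x *v h))\<bar>) has_integral (1 / 2) * measure lebesgue U) U"
    by (rule has_integral_eq[rotated]) (rule det[symmetric])
  then have "measure lebesgue (polar \<theta> ` U) = (1 / 2) * measure lebesgue U"
    using has_measure_differentiable_image[OF fmeasurableD[OF meas] has_derivative_polar[OF U(2)] inj]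
    by blast
  then show ?thesis by simp
qed

lemma norm_polar: "x $ 1 \<ge> 0 \<Longrightarrow> norm (polar \<theta> x) = sqrt (x $ 1)"
proof -
  assume "x $ 1 \<ge> 0"
  then have "(sqrt (x $ 1) * cos (\<theta> + x $ 2))\<^sup>2 + (sqrt (x $ 1) * sin (\<theta> + x $ 2))\<^sup>2 = x $ 1"
    by (simp add: power_mult_distrib flip: distrib_left)
  then show ?thesis
    by (simp add: norm_vec_def L2_set_def sum_2 polar_def)
qed

lemma dist_polar:
  assumes "x $ 1 \<ge> 0" "y $ 1 \<ge> 0"
  shows "(dist (polar \<theta> x) (polar \<theta> y))\<^sup>2
    = x $ 1 + y $ 1 - 2 * sqrt (x $ 1) * sqrt (y $ 1) * cos (x $ 2 - y $ 2)"
proof -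
  have "polar \<theta> x \<bullet> polar \<theta> y = sqrt (x $ 1) * sqrt (y $ 1) * cos ((\<theta> + x $ 2) - (\<theta> + y $ 2))"
    unfolding cos_diff by (simp add: inner_vec_def sum_2 polar_def algebra_simps)
  moreover have "(dist (polar \<theta> x) (polar \<theta> y))\<^sup>2
    = (norm (polar \<theta> x))\<^sup>2 + (norm (polar \<theta> y))\<^sup>2 - 2 * (polar \<theta> x \<bullet> polar \<theta> y)"
    unfolding dist_norm power2_norm_eq_inner inner_diff_left inner_diff_right
    by (simp add: inner_commute)
  ultimately show ?thesis using assms by (simp add: norm_polar)
qed

lemma ex_polar:
  obtains t where "-pi < t" "t \<le> pi" "x = polar \<theta> (vec2 ((norm x)\<^sup>2, t))"
proof -
  define r where "r = norm x"
  have r0: "0 \<le> r" by (simp add: r_def)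
  have r2: "r\<^sup>2 = (x $ 1)\<^sup>2 + (x $ 2)\<^sup>2"
    by (simp add: r_def norm_vec_def L2_set_def sum_2)
  obtain a where a: "x $ 1 = r * cos a" "x $ 2 = r * sin a"
  proof (cases "r = 0")
    case True
    then show ?thesis using that[of 0] by (simp add: r_def)
  next
    case False
    have "(x $ 1 / r)\<^sup>2 + (x $ 2 / r)\<^sup>2 = r\<^sup>2 / r\<^sup>2"
      unfolding power_divide r2[symmetric] add_divide_distrib[symmetric] ..
    also have "\<dots> = 1" using False by simp
    finally obtain a where "x $ 1 / r = cos a" "x $ 2 / r = sin a"
      by (rule sincos_total_2pi)
    then have "x $ 1 = r * cos a" "x $ 2 = r * sin a"
      using False by (metis nonzero_mult_div_cancel_left times_divide_eq_right)+
    then show ?thesis by (rule that)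
  qed
  obtain t where t: "-pi < t" "t \<le> pi" "sin t = sin (a - \<theta>)" "cos t = cos (a - \<theta>)"
    using sincos_principal_value by blast
  have "cos (\<theta> + t) = cos (\<theta> + (a - \<theta>))" "sin (\<theta> + t) = sin (\<theta> + (a - \<theta>))"
    unfolding cos_add sin_add t(3,4) by simp_all
  then have "x = polar \<theta> (vec2 (r\<^sup>2, t))"
    unfolding vec_eq_iff forall_2 polar_def vec2_nth fst_conv snd_conv by (simp add: a r0)
  then show ?thesis unfolding r_def by (rule that[OF t(1,2)])
qed

section \<open>Sets of diameter at most 2 in an annulus\<close>

text \<open>The hypothesis that every radius between the extreme ones occurs in \<open>K\<close> makes all slices
nonempty, as needed for adding the lengths of paired slices.\<close>

lemma measure_le_disc_area_of_radii_interval: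
  fixes K :: "(real ^ 2) set"
  assumes K: "compact K" and dist2: "\<And>x y. x \<in> K \<Longrightarrow> y \<in> K \<Longrightarrow> dist x y \<le> 2"
    and radii: "norm ` K = {r..r'}" and r: "2 \<le> r" "r \<le> r'" "r' \<le> 4"
  shows "measure lebesgue K \<le> disc_area (r\<^sup>2) (r'\<^sup>2)"
proof -
  define p q where "p = r\<^sup>2" and "q = r'\<^sup>2"
  have pq: "4 \<le> p" "p \<le> q" "q \<le> 16"
    using power_mono[OF r(1), of 2] power_mono[OF r(2), of 2] power_mono[OF r(3), of 2] r
    by (auto simp: p_def q_def)
  have "r \<in> norm ` K" unfolding radii using r by simp
  then obtain k0 where k0: "k0 \<in> K" by auto
  \<comment> \<open>Angles are measured from the direction of a point of \<open>K\<close>. As all radii are at least 2 and all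
    distances at most 2, every point of \<open>K\<close> then has its angle in \<open>{-pi/2..pi/2}\<close>, so angles
    are unique and their differences do not wrap around the circle.\<close>
  obtain \<theta> where th: "k0 = polar 0 (vec2 ((norm k0)\<^sup>2, \<theta>))" using ex_polar by metis
  then have th0: "k0 = polar \<theta> (vec2 ((norm k0)\<^sup>2, 0))"
    by (simp add: polar_def)
  have nrm: "r \<le> norm k \<and> norm k \<le> r'" if "k \<in> K" for k using radii that by auto
  define B :: "(real ^ 2) set" where "B = cbox (vec2 (p, - pi / 2)) (vec2 (q, pi / 2))"
  have B: "x \<in> B \<longleftrightarrow> p \<le> x $ 1 \<and> x $ 1 \<le> q \<and> \<bar>x $ 2\<bar> \<le> pi / 2" for x
    by (auto simp: B_def mem_box_cart forall_2 abs_le_iff)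
  define U where "U = B \<inter> polar \<theta> -` K"
  have cont: "continuous_on B (polar \<theta>)"
  proof (rule has_derivative_continuous_on)
    fix x assume "x \<in> B"
    then show "(polar \<theta> has_derivative (\<lambda>h. polar_jac \<theta> x *v h)) (at x within B)"
      using pq by (intro has_derivative_polar) (auto simp: B)
  qed
  have U: "compact U"
  proof -
    have "closed U" unfolding U_def
      by (rule continuous_closed_preimage[OF cont]) (use K in \<open>auto simp: B_def closed_cbox compact_imp_closed\<close>)
    moreover have "U = B \<inter> U" unfolding U_def by auto
    ultimately show ?thesis using compact_Int_closed[of B U] by (simp add: B_def compact_cbox)
  qed
  have U1: "x $ 1 > 0" "x $ 1 \<ge> 0" if "x \<in> U" for x using that pq by (auto simp: U_def B)
  have onto: "\<exists>t. \<bar>t\<bar> \<le> pi / 2 \<and> vec2 ((norm k)\<^sup>2, t) \<in> U \<and> k = polar \<theta> (vec2 ((norm k)\<^sup>2, t))"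
    if k: "k \<in> K" for k
  proof -
    obtain t where t: "-pi < t" "t \<le> pi" "k = polar \<theta> (vec2 ((norm k)\<^sup>2, t))"
      using ex_polar by metis
    have "(norm k)\<^sup>2 + (norm k0)\<^sup>2 - 2 * norm k * norm k0 * cos t = (dist k k0)\<^sup>2"
      using dist_polar[of "vec2 ((norm k)\<^sup>2, t)" "vec2 ((norm k0)\<^sup>2, 0)" \<theta>]
      unfolding t(3)[symmetric] th0[symmetric] by simp
    also have "\<dots> \<le> 2\<^sup>2" using dist2[OF k k0] by (intro power_mono) auto
    finally have le: "(norm k)\<^sup>2 + (norm k0)\<^sup>2 - 2 * norm k * norm k0 * cos t \<le> 4" by simp
    have n2: "2 \<le> norm k" "2 \<le> norm k0" using nrm[OF k] nrm[OF k0] r by auto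
    then have "4 \<le> (norm k)\<^sup>2" "4 \<le> (norm k0)\<^sup>2" using power_mono[of 2 "norm k" 2] power_mono[of 2 "norm k0" 2] by simp_all
    then have "0 < (2 * norm k * norm k0) * cos t" using le by linarith
    moreover have "0 < 2 * norm k * norm k0" using n2 by (intro mult_pos_pos) auto
    ultimately have c: "cos t > 0" using zero_less_mult_pos by blast
    have tle: "\<bar>t\<bar> \<le> pi / 2"
    proof (rule ccontr)
      assume "\<not> \<bar>t\<bar> \<le> pi / 2"
      then have "cos \<bar>t\<bar> \<le> cos (pi / 2)" using t(1,2) by (intro cos_monotone_0_pi_le) auto
      then show False using c by simp
    qed
    have "vec2 ((norm k)\<^sup>2, t) \<in> U"
      using k t(3) tle nrm[OF k] r by (auto simp: U_def B p_def q_def intro!: power_mono)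
    then show ?thesis using t(3) tle by blast
  qed
  have img: "polar \<theta> ` U = K"
    using onto unfolding U_def by fast
  have angle: "\<bar>x $ 2 - y $ 2\<bar> \<le> pi" if "x \<in> U" "y \<in> U" for x y
    using that by (auto simp: U_def B abs_le_iff)
  have inj: "inj_on (polar \<theta>) U"
  proof (rule inj_onI)
    fix x y assume xy: "x \<in> U" "y \<in> U" and eq: "polar \<theta> x = polar \<theta> y"
    from arg_cong[OF eq, of norm] have 1: "x $ 1 = y $ 1"
      using U1[OF xy(1)] U1[OF xy(2)] by (simp add: norm_polar)
    have "0 = x $ 1 + y $ 1 - 2 * sqrt (x $ 1) * sqrt (y $ 1) * cos (x $ 2 - y $ 2)"
      using dist_polar[of x y \<theta>] U1[OF xy(1)] U1[OF xy(2)] eq by simp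
    then have "cos (x $ 2 - y $ 2) = 1"
      using 1 U1[OF xy(2)] by (simp add: mult.assoc[symmetric])
    then have "cos \<bar>x $ 2 - y $ 2\<bar> = cos 0" by simp
    then have "\<bar>x $ 2 - y $ 2\<bar> = 0" using angle[OF xy] by (intro cos_inj_pi[OF _ _ _ _ \<open>cos \<bar>x $ 2 - y $ 2\<bar> = cos 0\<close>]) simp_all
    then show "x = y" using 1 by (simp add: vec_eq_iff forall_2)
  qed
  have meas: "measure lebesgue K = measure lebesgue U / 2"
    using measure_polar_image[OF U U1(1) inj] by (simp add: img)
  \<comment> \<open>The set of angles of the points of \<open>K\<close> with squared radius \<open>u\<close>, and its length.\<close>
  define L where "L u = {t. vec2 (u, t) \<in> U}" for u
  define g where "g u = emeasure lborel (L u)" for u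
  have Ub: "U \<in> sets borel" using U by (simp add: borel_compact)
  note sl = emeasure_lborel_slices[OF Ub, folded L_def, folded g_def]
  have [measurable]: "g \<in> borel_measurable borel" by (rule sl(2))
  have L0: "L u = {}" if "u \<notin> {p..q}" for u using that by (auto simp: L_def U_def B)
  have Lne: "L u \<noteq> {}" if "u \<in> {p..q}" for u
  proof -
    have "r \<le> sqrt u" "sqrt u \<le> r'" using that r by (auto simp: p_def q_def intro: real_le_rsqrt real_le_lsqrt)
    then have "sqrt u \<in> norm ` K" unfolding radii by simp
    then obtain k where "k \<in> K" "norm k = sqrt u" by auto
    with onto[of k] that pq show ?thesis by (auto simp: L_def)
  qed
  have cross: "\<bar>s - t\<bar> \<le> paired_angle u v"
    if uv: "u \<in> {p..q}" "v \<in> {p..q}" and st: "s \<in> L u" "t \<in> L v" for u v s t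
  proof -
    have pos: "u > 0" "v > 0" and uv': "u \<in> {4..16}" "v \<in> {4..16}" using uv pq by auto
    have mem: "vec2 (u, s) \<in> U" "vec2 (v, t) \<in> U" using st by (auto simp: L_def)
    then have "dist (polar \<theta> (vec2 (u, s))) (polar \<theta> (vec2 (v, t))) \<le> 2"
      by (intro dist2) (auto simp: U_def)
    from power_mono[OF this, of 2]
    have "u + v - 2 * sqrt u * sqrt v * cos (s - t) \<le> 4"
      using pos by (simp add: dist_polar)
    then have "(u + v - 4) / (2 * sqrt u * sqrt v) \<le> cos (s - t)"
      using pos by (simp add: divide_le_eq mult_ac)
    then have "cos (paired_angle u v) \<le> cos \<bar>s - t\<bar>"
      unfolding cos_paired_angle(1)[OF uv'] by simp
    then show ?thesis
      using cos_paired_angle(2)[OF uv'] angle[OF mem] by (subst (asm) cos_mono_le_eq) auto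
  qed
  have pair: "g u + g (p + q - u) \<le> ennreal (indicator {p..q} u * (2 * paired_angle u (p + q - u)))" for u
  proof (cases "u \<in> {p..q}")
    case True
    then have "p + q - u \<in> {p..q}" by auto
    with True show ?thesis
      unfolding g_def using emeasure_add_le_of_cross_dist_le[OF Lne Lne cross] by simp
  next
    case False
    then have "p + q - u \<notin> {p..q}" by auto
    with False show ?thesis by (simp add: g_def L0)
  qed
  have "((\<lambda>u. 2 * paired_angle u (p + q - u)) has_integral 2 * (2 * disc_area p q)) {p..q}"
    by (intro has_integral_mult_right has_integral_paired_angle pq)
  moreover have "0 \<le> 2 * paired_angle u (p + q - u)" if "u \<in> {p..q}" for u
    using cos_paired_angle(2)[of u "p + q - u"] that pq by auto
  ultimately have int: "(\<integral>\<^sup>+u. ennreal (indicator {p..q} u * (2 * paired_angle u (p + q - u))) \<partial>lborel)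
      = ennreal (4 * disc_area p q)"
    using nn_integral_has_integral_lebesgue[of "{p..q}" "\<lambda>u. 2 * paired_angle u (p + q - u)"] by simp
  \<comment> \<open>The reflection \<open>u \<mapsto> p + q - u\<close> preserves the integral, so twice the area of \<open>U\<close> is the
    integral of the paired lengths.\<close>
  have "(\<integral>\<^sup>+u. g u \<partial>lborel) = (\<integral>\<^sup>+u. g (p + q - u) \<partial>lborel)"
    using nn_integral_real_affine[of g "-1" "p + q"] by simp
  then have "2 * emeasure lborel U = (\<integral>\<^sup>+u. g u \<partial>lborel) + (\<integral>\<^sup>+u. g (p + q - u) \<partial>lborel)"
    unfolding sl(1) by (simp add: mult_2)
  also have "\<dots> = (\<integral>\<^sup>+u. g u + g (p + q - u) \<partial>lborel)"
    by (rule nn_integral_add[symmetric]) simp_all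
  also have "\<dots> \<le> (\<integral>\<^sup>+u. ennreal (indicator {p..q} u * (2 * paired_angle u (p + q - u))) \<partial>lborel)"
    by (rule nn_integral_mono) (rule pair)
  also have "\<dots> = ennreal (4 * disc_area p q)" by (rule int)
  finally have "ennreal (2 * measure lebesgue U) \<le> ennreal (4 * disc_area p q)"
    using U Ub by (simp add: emeasure_eq_measure2 fmeasurable_compact ennreal_mult emeasure_eq_ennreal_measure)
  moreover have "disc_area p q \<ge> 0"
    using disc_area_mono[of p p p q] pq by (simp add: disc_area_def)
  ultimately have "2 * measure lebesgue U \<le> 4 * disc_area p q" by simp
  then show ?thesis unfolding meas p_def[symmetric] q_def[symmetric] by simp
qed

theorem theorem1p8:
  fixes R a :: real and D A :: "(real ^ 2) set"
  assumes "R \<in> {2 * sqrt 2..4}"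
    and "D = cball 0 R - interior (cball 0 2)"
    and "A \<in> sets lebesgue" and "A \<subseteq> D"
    and "diameter A \<le> 2"
    and "a = sqrt ((- (R ^ 4) + 16 * R\<^sup>2) / (8 * (R\<^sup>2 + 2)))"
  shows "measure lebesgue A \<le> R\<^sup>2 * arcsin (a / R) - 4 * arcsin (a / 2) + 2 * arccos a"
proof -
  have "1 \<le> sqrt 2" by simp
  with assms(1) have R: "2 \<le> R" "R \<le> 4" unfolding atLeastAtMost_iff by linarith+
  have R2: "4 \<le> R\<^sup>2" "R\<^sup>2 \<le> 16" using power_mono[OF R(1), of 2] power_mono[OF R(2), of 2] R by auto
  have D: "D = {x. 2 \<le> norm x \<and> norm x \<le> R}"
    unfolding assms(2) interior_cball by (auto simp: not_less)
  have compD: "compact D" unfolding assms(2) by (intro compact_diff) auto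
  have "measure lebesgue A \<le> disc_area 4 (R\<^sup>2)"
  proof (cases "A = {}")
    case True
    then show ?thesis using disc_area_mono[of 4 4 4 "R\<^sup>2"] R2 by (simp add: disc_area_def)
  next
    case False
    have bA: "bounded A" using bounded_subset[OF compact_imp_bounded[OF compD] assms(4)] .
    have clA: "closure A \<subseteq> D" using closure_minimal[OF assms(4)] compD compact_imp_closed by blast
    define H where "H = convex hull (closure A)"
    define K where "K = H \<inter> D"
    have "compact (closure A)" using bA by simp
    then have compH: "compact H" unfolding H_def by (rule compact_convex_hull)
    have distA: "dist x y \<le> 2" if "x \<in> closure A" "y \<in> closure A" for x y
      using diameter_bounded_bound[OF bounded_closure[OF bA] that] assms(5) diameter_closure[OF bA] by simp
    have distH1: "H \<subseteq> cball x 2" if "x \<in> closure A" for x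
      unfolding H_def by (rule hull_minimal) (use distA that in auto)
    have distH: "H \<subseteq> cball y 2" if "y \<in> H" for y
    proof -
      have "closure A \<subseteq> cball y 2"
        using distH1 that by (auto simp: subset_eq dist_commute)
      then show ?thesis unfolding H_def by (rule hull_minimal) simp
    qed
    have distK: "dist x y \<le> 2" if "x \<in> K" "y \<in> K" for x y
      using distH[of x] that unfolding K_def by (simp add: subset_eq)
    have AK: "A \<subseteq> K"
      using assms(4) hull_subset[of "closure A" convex] closure_subset[of A] by (auto simp: K_def H_def)
    have compK: "compact K" unfolding K_def using compH compD by blast
    \<comment> \<open>The radii of the points of \<open>K\<close> are those of the connected set \<open>H\<close> that lie in \<open>{2..R}\<close>.\<close>
    have "norm ` K = norm ` H \<inter> {2..R}" by (auto simp: K_def D)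
    moreover have "connected (norm ` H)"
      by (intro connected_continuous_image continuous_intros convex_connected) (simp add: H_def)
    ultimately have "connected (norm ` K)"
      by (simp add: is_interval_Int flip: is_interval_connected_1)
    moreover have "compact (norm ` K)" using compK by (intro compact_continuous_image continuous_intros)
    ultimately obtain r r' where rr: "norm ` K = {r..r'}"
      using connected_compact_interval_1[of "norm ` K"] by auto
    moreover have "K \<noteq> {}" using AK False by auto
    ultimately have "r \<le> r'" by (metis atLeastatMost_empty_iff image_is_empty)
    then have "r \<in> norm ` K" "r' \<in> norm ` K" unfolding rr by auto
    then have r: "2 \<le> r" "r' \<le> R" by (auto simp: K_def D)
    have "measure lebesgue A \<le> measure lebesgue K"
      using AK assms(3) compK by (intro measure_mono_fmeasurable lmeasurable_compact)
    also have "\<dots> \<le> disc_area (r\<^sup>2) (r'\<^sup>2)"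
      using compK distK rr r R \<open>r \<le> r'\<close>
      by (intro measure_le_disc_area_of_radii_interval) simp_all
    also have "\<dots> \<le> disc_area 4 (R\<^sup>2)"
      using r R R2 \<open>r \<le> r'\<close> power_mono[OF r(1), of 2]
      by (intro disc_area_mono) (auto intro!: power_mono)
    finally show ?thesis .
  qed
  then show ?thesis using disc_area_annulus[OF R assms(6)] by simp
qed

end
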